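(* Let $\mathbf q=(q_{ij})$ be an $N\times M$ matrix (rows are commodities, columns are countries) with non-negative entries such that every row and every column contains at least one strictly positive entry. Let $d_{ij}\ge0$ and $e_{ij}\ge0$ $(i=1,\dots,N,\ j=1,\dots,M)$ satisfy $d_{ij}>0\Leftrightarrow e_{ij}>0\Leftrightarrow q_{ij}>0$. Consider the system of equations in $f_1,\dots,f_M$ and $g_1,\dots,g_N$: $$f_j=\sum_{n=1}^{N}\frac{d_{nj}}{\sum_{k=1}^{N}d_{kj}}\,\frac{e_{nj}}{g_n}\quad(j=1,\dots,M),\qquad g_i=\sum_{m=1}^{M}\frac{d_{im}}{\sum_{k=1}^{M}d_{ik}}\,\frac{e_{im}}{f_m}\quad(i=1,\dots,N).$$ Then connectedness of the countries through the quantity matrix $\mathbf q$ is both necessary and sufficient for uniqueness of the solutions (up to a positive scalar multiple).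
   Context: Connectedness of $\mathbf q$: for every nonempty proper subset $J\subset\{1,\dots,M\}$ there exist $j\in J$, $l\in\{1,\dots,M\}\setminus J$ and $k\in\{1,\dots,N\}$ such that $q_{kj}>0$ and $q_{kl}>0$. The unknowns $f_j$, $g_i$ stand for values of non-negative functions and appear in denominators, so solutions are understood with $f_j>0$, $g_i>0$. If $(f,g)$ solves the system then so does $(\delta f,\delta^{-1}g)$ for every $\delta>0$; uniqueness up to a positive scalar multiple means uniqueness up to this rescaling. *)

theory Defs
  imports "HOL-Analysis.Analysis"
begin

text \<open>
  An \<open>N \<times> M\<close> matrix has type \<open>real ^ 'm ^ 'n\<close>, with \<open>N = CARD('n)\<close> rows (commodities)
  and \<open>M = CARD('m)\<close> columns (countries); the entry \<open>q\<^sub>i\<^sub>j\<close> is \<open>q $ i $ j\<close>.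
\<close>

definition countries_connected :: "real ^ 'm ^ 'n \<Rightarrow> bool" where
  "countries_connected q \<longleftrightarrow>
     (\<forall>J :: 'm set. J \<noteq> {} \<and> J \<noteq> UNIV \<longrightarrow>
        (\<exists>j\<in>J. \<exists>l\<in>UNIV - J. \<exists>k. q $ k $ j > 0 \<and> q $ k $ l > 0))"

text \<open>
  The unknowns occur as denominators and stand for values of non-negative functions, so
  positivity of all components is part of being a solution.
\<close>

definition is_solution ::
  "real ^ 'm ^ 'n \<Rightarrow> real ^ 'm ^ 'n \<Rightarrow> real ^ 'm \<Rightarrow> real ^ 'n \<Rightarrow> bool" where
  "is_solution d e f g \<longleftrightarrow>
     (\<forall>j. f $ j > 0) \<and> (\<forall>i. g $ i > 0) \<and>
     (\<forall>j. f $ j = (\<Sum>n\<in>UNIV. d $ n $ j / (\<Sum>k\<in>UNIV. d $ k $ j) * (e $ n $ j / g $ n))) \<and>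
     (\<forall>i. g $ i = (\<Sum>m\<in>UNIV. d $ i $ m / (\<Sum>k\<in>UNIV. d $ i $ k) * (e $ i $ m / f $ m)))"

text \<open>
  Uniqueness proper, that is, at most one solution up to rescaling; existence is not included.
\<close>

definition solutions_unique_up_to_scaling :: "real ^ 'm ^ 'n \<Rightarrow> real ^ 'm ^ 'n \<Rightarrow> bool" where
  "solutions_unique_up_to_scaling d e \<longleftrightarrow>
     (\<forall>f g f' g'. is_solution d e f g \<and> is_solution d e f' g' \<longrightarrow>
        (\<exists>\<delta>>0. f' = \<delta> *\<^sub>R f \<and> g' = inverse \<delta> *\<^sub>R g))"

end

theory Submission imports Defs begin

text \<open>
  Multiplying out the denominators, a solution is a diagonal scaling
  \<open>K\<^sub>i\<^sub>j = d\<^sub>i\<^sub>j e\<^sub>i\<^sub>j / (f\<^sub>j g\<^sub>i)\<close> with the same row and column sums as \<open>d\<close>.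
  With \<open>f = exp u\<close> and \<open>g = exp v\<close>, these are the critical point equations of the convex
  function \<open>\<Sum>\<^sub>i\<^sub>j d\<^sub>i\<^sub>j e\<^sub>i\<^sub>j exp (-s\<^sub>i\<^sub>j) + d\<^sub>i\<^sub>j s\<^sub>i\<^sub>j\<close> of \<open>s\<^sub>i\<^sub>j = u\<^sub>j + v\<^sub>i\<close>. Since \<open>e\<close> and \<open>d\<close> have
  the same support, this function is coercive in \<open>s\<close> restricted to that support, so it attains
  its minimum and solutions always exist. If a set \<open>J\<close> of countries is disconnected from the
  rest, a solution can be rescaled on \<open>J\<close> alone. If the countries are connected, a maximum
  principle for \<open>f' / f\<close> shows that this quotient is constant.
\<close>

section \<open>Two real inequalities\<close>

text \<open>The terms \<open>c i * (1 - x i)\<close> sum to 0 and all have the same sign, so each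
  vanishes. Indices of weight 0 contribute nothing, so the one-sided bound is asked for only where
  \<open>c i > 0\<close>.\<close>

lemma weighted_sum_extremal:
  fixes c x :: "'a \<Rightarrow> real"
  assumes "finite A" "\<And>i. i \<in> A \<Longrightarrow> c i \<ge> 0"
    and "(\<forall>i\<in>A. c i > 0 \<longrightarrow> x i \<le> 1) \<or> (\<forall>i\<in>A. c i > 0 \<longrightarrow> x i \<ge> 1)"
    and "(\<Sum>i\<in>A. c i * x i) = (\<Sum>i\<in>A. c i)" "i \<in> A" "c i > 0"
  shows "x i = 1"
proof -
  have zero: "(\<Sum>i\<in>A. c i * (x i - 1)) = 0" "(\<Sum>i\<in>A. c i * (1 - x i)) = 0"
    using assms(4) by (simp_all add: algebra_simps sum_subtractf)
  consider "\<forall>i\<in>A. c i > 0 \<longrightarrow> x i \<le> 1" | "\<forall>i\<in>A. c i > 0 \<longrightarrow> x i \<ge> 1"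
    using assms(3) by blast
  then have "c i * (x i - 1) = 0 \<or> c i * (1 - x i) = 0"
  proof cases
    case 1
    have "c k * (1 - x k) \<ge> 0" if "k \<in> A" for k
      using 1 assms(2)[OF that] that by (cases "c k = 0") auto
    then show ?thesis
      using zero(2) assms(1,5) by (simp add: sum_nonneg_eq_0_iff)
  next
    case 2
    have "c k * (x k - 1) \<ge> 0" if "k \<in> A" for k
      using 2 assms(2)[OF that] that by (cases "c k = 0") auto
    then show ?thesis
      using zero(1) assms(1,5) by (simp add: sum_nonneg_eq_0_iff)
  qed
  then show ?thesis
    using assms(6) by auto
qed

text \<open>The linear term gives growth for positive s, the exponential for negative s. The
  equivalence excludes \<open>w = 0\<close> with \<open>d > 0\<close>, where the right-hand side is
  unbounded below.\<close>

lemma exp_plus_linear_coercive: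
  fixes w d :: real
  assumes "w \<ge> 0" "d \<ge> 0" "w > 0 \<longleftrightarrow> d > 0"
  shows "\<exists>C. \<forall>s. d * \<bar>s\<bar> - C \<le> w * exp (- s) + d * s"
proof (cases "d > 0")
  case True
  then have w: "w > 0"
    using assms by simp
  \<comment> \<open>At \<open>s = - t\<close> the tangent to \<open>w * exp (- s)\<close> has slope
    \<open>- 2 * d\<close>: one d cancels \<open>d * s\<close> for negative s, the other leaves
    \<open>d * \<bar>s\<bar>\<close>.\<close>
  define t where "t = ln (2 * d / w)"
  have wt: "w * exp t = 2 * d"
    using True w by (simp add: t_def)
  have "d * \<bar>s\<bar> - 2 * d * \<bar>1 - t\<bar> \<le> w * exp (- s) + d * s" for s
  proof (cases "s \<ge> 0")
    case True
    moreover have "2 * d * \<bar>1 - t\<bar> \<ge> 0" "w * exp (- s) \<ge> 0"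
      using assms by simp_all
    ultimately show ?thesis
      by simp
  next
    case False
    have "2 * d * (1 - s - t) \<le> 2 * d * exp (- s - t)"
      using exp_ge_add_one_self[of "- s - t"] assms(2) by (intro mult_left_mono) linarith+
    also have "\<dots> = w * (exp t * exp (- s - t))"
      using wt by (metis mult.assoc)
    also have "\<dots> = w * exp (- s)"
      by (simp flip: exp_add)
    finally have "2 * d * (1 - s - t) \<le> w * exp (- s)" .
    moreover have "2 * d * - \<bar>1 - t\<bar> \<le> 2 * d * (1 - t)"
      using assms(2) by (intro mult_left_mono) auto
    ultimately show ?thesis
      using False by (simp add: algebra_simps)
  qed
  then show ?thesis
    by blast
next
  case False
  then have "d = 0" "w = 0"
    using assms by auto
  then show ?thesis
    by (intro exI[of _ 0]) simp
qed

lemma is_solution_pos: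
  assumes "is_solution d e f g"
  shows "f $ j > 0" "g $ i > 0"
  using assms unfolding is_solution_def by blast+

section \<open>Solutions as scalings with prescribed row and column sums\<close>

locale same_support =
  fixes d e :: "real ^ 'm ^ 'n"
  assumes d_nonneg: "d $ i $ j \<ge> 0"
    and e_nonneg: "e $ i $ j \<ge> 0"
    and d_pos_iff: "d $ i $ j > 0 \<longleftrightarrow> e $ i $ j > 0"
    and d_row: "\<exists>j. d $ i $ j > 0"
    and d_col: "\<exists>i. d $ i $ j > 0"
begin

lemma row_sum_pos: "(\<Sum>j\<in>UNIV. d $ i $ j) > 0"
  using d_row[of i] d_nonneg by (metis UNIV_I finite sum_pos2)

lemma col_sum_pos: "(\<Sum>i\<in>UNIV. d $ i $ j) > 0"
  using d_col[of j] d_nonneg by (metis (no_types, lifting) UNIV_I finite sum_pos2)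

lemma de_pos_iff: "d $ i $ j * e $ i $ j > 0 \<longleftrightarrow> d $ i $ j > 0"
  using d_nonneg[of i j] e_nonneg[of i j] d_pos_iff[of i j]
  by (auto simp: zero_less_mult_iff)

text \<open>In each equation the unknown on the left and the row or column sum of \<open>d\<close>
  trade places. Apart from positivity, the result depends on f and g only through the products
  \<open>f $ j * g $ i\<close>.\<close>

lemma is_solution_iff_scaling:
  "is_solution d e f g \<longleftrightarrow>
     (\<forall>j. f $ j > 0) \<and> (\<forall>i. g $ i > 0) \<and>
     (\<forall>j. (\<Sum>i\<in>UNIV. d $ i $ j * e $ i $ j / (f $ j * g $ i)) = (\<Sum>i\<in>UNIV. d $ i $ j)) \<and>
     (\<forall>i. (\<Sum>j\<in>UNIV. d $ i $ j * e $ i $ j / (f $ j * g $ i)) = (\<Sum>j\<in>UNIV. d $ i $ j))"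
proof (cases "(\<forall>j. f $ j > 0) \<and> (\<forall>i. g $ i > 0)")
  case True
  have swap: "x = S / c \<longleftrightarrow> S / x = c" if "x > 0" "c > 0" for x S c :: real
    using that by (auto simp: field_simps)
  have "f $ j = (\<Sum>i\<in>UNIV. d $ i $ j / (\<Sum>k\<in>UNIV. d $ k $ j) * (e $ i $ j / g $ i)) \<longleftrightarrow>
      (\<Sum>i\<in>UNIV. d $ i $ j * e $ i $ j / (f $ j * g $ i)) = (\<Sum>i\<in>UNIV. d $ i $ j)" for j
  proof -
    have "(\<Sum>i\<in>UNIV. d $ i $ j / (\<Sum>k\<in>UNIV. d $ k $ j) * (e $ i $ j / g $ i)) =
        (\<Sum>i\<in>UNIV. d $ i $ j * e $ i $ j / g $ i) / (\<Sum>k\<in>UNIV. d $ k $ j)"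
      by (simp add: sum_divide_distrib mult.commute)
    moreover have "(\<Sum>i\<in>UNIV. d $ i $ j * e $ i $ j / (f $ j * g $ i)) =
        (\<Sum>i\<in>UNIV. d $ i $ j * e $ i $ j / g $ i) / f $ j"
      by (simp add: sum_divide_distrib mult.commute)
    ultimately show ?thesis
      using True col_sum_pos[of j] by (simp only: swap)
  qed
  moreover have "g $ i = (\<Sum>j\<in>UNIV. d $ i $ j / (\<Sum>k\<in>UNIV. d $ i $ k) * (e $ i $ j / f $ j)) \<longleftrightarrow>
      (\<Sum>j\<in>UNIV. d $ i $ j * e $ i $ j / (f $ j * g $ i)) = (\<Sum>j\<in>UNIV. d $ i $ j)" for i
  proof -
    have "(\<Sum>j\<in>UNIV. d $ i $ j / (\<Sum>k\<in>UNIV. d $ i $ k) * (e $ i $ j / f $ j)) =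
        (\<Sum>j\<in>UNIV. d $ i $ j * e $ i $ j / f $ j) / (\<Sum>k\<in>UNIV. d $ i $ k)"
      by (simp add: sum_divide_distrib mult.commute)
    moreover have "(\<Sum>j\<in>UNIV. d $ i $ j * e $ i $ j / (f $ j * g $ i)) =
        (\<Sum>j\<in>UNIV. d $ i $ j * e $ i $ j / f $ j) / g $ i"
      by (simp add: sum_divide_distrib)
    ultimately show ?thesis
      using True row_sum_pos[of i] by (simp only: swap)
  qed
  ultimately show ?thesis
    unfolding is_solution_def by simp
qed (auto simp: is_solution_def)

section \<open>Existence of a solution by minimising a potential\<close>

text \<open>Taken as a function of s rather than of the pair (u, v): shifting u by a constant and v
  by its negative leaves s unchanged, so sublevel sets in (u, v) are never bounded when
  nonempty.\<close>

definition potential :: "real ^ 'm ^ 'n \<Rightarrow> real" where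
  "potential s = (\<Sum>i\<in>UNIV. \<Sum>j\<in>UNIV. d $ i $ j * e $ i $ j * exp (- s $ i $ j) + d $ i $ j * s $ i $ j)"

text \<open>
  Setting \<open>s\<^sub>i\<^sub>j = 0\<close> off the support is what makes the sublevel sets of the potential on the
  range of this map bounded.
\<close>

definition log_scaling :: "(real ^ 'm) \<times> (real ^ 'n) \<Rightarrow> real ^ 'm ^ 'n" where
  "log_scaling p = (\<chi> i j. if d $ i $ j > 0 then fst p $ j + snd p $ i else 0)"

lemma linear_log_scaling: "linear log_scaling"
  by (rule linearI) (simp_all add: log_scaling_def vec_eq_iff algebra_simps)

lemma bounded_sublevel:
  "bounded {s \<in> range log_scaling. potential s \<le> B}"
proof -
  have "\<exists>C. \<forall>s. d $ i $ j * \<bar>s\<bar> - C \<le> d $ i $ j * e $ i $ j * exp (- s) + d $ i $ j * s" for i j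
    using d_nonneg e_nonneg de_pos_iff by (intro exp_plus_linear_coercive) auto
  then obtain C where C: "\<And>i j s. d $ i $ j * \<bar>s\<bar> - C i j \<le>
      d $ i $ j * e $ i $ j * exp (- s) + d $ i $ j * s"
    by metis
  define D where "D = B + (\<Sum>i\<in>UNIV. \<Sum>j\<in>UNIV. C i j)"
  have "norm s \<le> (\<Sum>i\<in>UNIV. \<Sum>j\<in>UNIV. D / d $ i $ j)"
    if s: "s \<in> range log_scaling" "potential s \<le> B" for s
  proof -
    have "(\<Sum>i\<in>UNIV. \<Sum>j\<in>UNIV. d $ i $ j * \<bar>s $ i $ j\<bar> - C i j) \<le> potential s"
      unfolding potential_def by (intro sum_mono C)
    then have sum_le: "(\<Sum>i\<in>UNIV. \<Sum>j\<in>UNIV. d $ i $ j * \<bar>s $ i $ j\<bar>) \<le> D"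
      using s by (simp add: D_def sum_subtractf)
    have entry: "\<bar>s $ i $ j\<bar> \<le> D / d $ i $ j" for i j
    proof (cases "d $ i $ j > 0")
      case True
      have "d $ i $ j * \<bar>s $ i $ j\<bar> \<le> (\<Sum>j\<in>UNIV. d $ i $ j * \<bar>s $ i $ j\<bar>)"
        using d_nonneg by (intro member_le_sum) auto
      also have "\<dots> \<le> (\<Sum>i\<in>UNIV. \<Sum>j\<in>UNIV. d $ i $ j * \<bar>s $ i $ j\<bar>)"
        using d_nonneg
        by (intro member_le_sum[where f = "\<lambda>i. \<Sum>j\<in>UNIV. d $ i $ j * \<bar>s $ i $ j\<bar>"] sum_nonneg) auto
      finally have "d $ i $ j * \<bar>s $ i $ j\<bar> \<le> D"
        using sum_le by linarith
      with True show ?thesis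
        by (simp add: field_simps)
    next
      case False
      then have "d $ i $ j = 0"
        using d_nonneg[of i j] by simp
      \<comment> \<open>Both sides are 0: s vanishes off the support, and
        \<open>D / 0 = 0\<close>.\<close>
      then show ?thesis
        using s(1) by (auto simp: log_scaling_def)
    qed
    have "norm s \<le> (\<Sum>i\<in>UNIV. norm (s $ i))"
      unfolding norm_vec_def by (rule L2_set_le_sum) simp
    also have "\<dots> \<le> (\<Sum>i\<in>UNIV. \<Sum>j\<in>UNIV. \<bar>s $ i $ j\<bar>)"
      by (intro sum_mono norm_le_l1_cart)
    also have "\<dots> \<le> (\<Sum>i\<in>UNIV. \<Sum>j\<in>UNIV. D / d $ i $ j)"
      by (intro sum_mono entry)
    finally show ?thesis .
  qed
  then show ?thesis
    unfolding bounded_iff by blast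
qed

lemma potential_attains_inf: "\<exists>p. \<forall>p'. potential (log_scaling p) \<le> potential (log_scaling p')"
proof -
  \<comment> \<open>This level makes S nonempty, and points of the range outside S have larger
    potential than \<open>log_scaling 0\<close>, so a minimum on S is global.\<close>
  define S where "S = {s \<in> range log_scaling. potential s \<le> potential (log_scaling 0)}"
  have cont: "continuous_on A potential" for A
    unfolding potential_def by (intro continuous_intros)
  have "closed (range log_scaling)"
    by (intro closed_subspace linear_subspace_image linear_log_scaling subspace_UNIV)
  moreover have "closed {s. potential s \<le> potential (log_scaling 0)}"
    by (intro closed_Collect_le cont continuous_intros)
  ultimately have "closed S"
    unfolding S_def Collect_conj_eq Collect_mem_eq by (rule closed_Int)
  then have "compact S"
    unfolding S_def using bounded_sublevel by (simp add: compact_eq_bounded_closed)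
  moreover have "S \<noteq> {}"
    unfolding S_def by blast
  ultimately obtain s where s: "s \<in> S" "\<And>s'. s' \<in> S \<Longrightarrow> potential s \<le> potential s'"
    using continuous_attains_inf cont by metis
  obtain p where p: "s = log_scaling p"
    using s(1) by (auto simp: S_def)
  have "potential (log_scaling p) \<le> potential (log_scaling p')" for p'
  proof (cases "log_scaling p' \<in> S")
    case True
    then show ?thesis
      using s(2) p by simp
  next
    case False
    then have "potential (log_scaling 0) \<le> potential (log_scaling p')"
      by (auto simp: S_def)
    moreover have "potential s \<le> potential (log_scaling 0)"
      using s(1) by (simp add: S_def)
    ultimately show ?thesis
      using p by simp
  qed
  then show ?thesis
    by blast
qed

text \<open>Linearity keeps the line through \<open>log_scaling p\<close> in direction
  \<open>log_scaling h\<close> inside the range, so the directional derivative vanishes at the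
  minimum.\<close>

lemma potential_critical:
  assumes min: "\<And>p'. potential (log_scaling p) \<le> potential (log_scaling p')"
  shows "(\<Sum>i\<in>UNIV. \<Sum>j\<in>UNIV.
      (d $ i $ j - d $ i $ j * e $ i $ j * exp (- log_scaling p $ i $ j)) * log_scaling h $ i $ j) = 0"
    (is "?D = 0")
proof -
  define \<phi> where "\<phi> t = potential (log_scaling p + t *\<^sub>R log_scaling h)" for t
  have "(\<phi> has_real_derivative ?D) (at 0)"
    unfolding \<phi>_def potential_def
    by (rule DERIV_sum derivative_eq_intros refl | simp add: algebra_simps)+
  moreover have "\<phi> 0 \<le> \<phi> t" for t
  proof -
    have "log_scaling p + t *\<^sub>R log_scaling h = log_scaling (p + t *\<^sub>R h)"
      using linear_log_scaling by (simp add: linear_add linear_scale)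
    then show ?thesis
      using min by (simp add: \<phi>_def)
  qed
  ultimately show ?thesis
    using DERIV_local_min[of \<phi> ?D 0 1] by simp
qed

lemma solution_exists: "\<exists>f g. is_solution d e f g"
proof -
  obtain p where p: "\<And>p'. potential (log_scaling p) \<le> potential (log_scaling p')"
    using potential_attains_inf by blast
  define R where "R i j = d $ i $ j - d $ i $ j * e $ i $ j * exp (- log_scaling p $ i $ j)" for i j
  have crit: "(\<Sum>i\<in>UNIV. \<Sum>j\<in>UNIV. R i j * log_scaling h $ i $ j) = 0" for h
    using potential_critical[OF p] by (simp add: R_def)
  \<comment> \<open>Hence the cut-off in \<open>log_scaling\<close> does not affect the sums below:
    testing with a unit vector in u or v yields a full column or row sum of R.\<close>
  have R0: "R i j = 0" if "\<not> d $ i $ j > 0" for i j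
    using that d_nonneg[of i j] by (simp add: R_def)
  have col: "(\<Sum>i\<in>UNIV. R i j) = 0" for j
  proof -
    have "R i l * log_scaling (axis j 1, 0) $ i $ l = (if l = j then R i l else 0)" for i l
      by (simp add: log_scaling_def axis_def R0)
    then show ?thesis
      using crit[of "(axis j 1, 0)"] by simp
  qed
  have row: "(\<Sum>j\<in>UNIV. R i j) = 0" for i
  proof -
    have "R k j * log_scaling (0, axis i 1) $ k $ j = (if k = i then R k j else 0)" for k j
      by (simp add: log_scaling_def axis_def R0)
    then have "(\<Sum>k\<in>UNIV. \<Sum>j\<in>UNIV. if k = i then R k j else 0) = 0"
      using crit[of "(0, axis i 1)"] by simp
    then show ?thesis
      by (subst (asm) sum.swap) simp
  qed
  define f :: "real ^ 'm" where "f = (\<chi> j. exp (fst p $ j))"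
  define g :: "real ^ 'n" where "g = (\<chi> i. exp (snd p $ i))"
  have "d $ i $ j * e $ i $ j / (f $ j * g $ i) = d $ i $ j - R i j" for i j
    using d_nonneg[of i j]
    by (cases "d $ i $ j > 0")
      (auto simp: R_def f_def g_def log_scaling_def exp_minus exp_add exp_diff field_simps)
  then have "is_solution d e f g"
    using col row unfolding is_solution_iff_scaling
    by (simp add: sum_subtractf f_def g_def)
  then show ?thesis
    by blast
qed

text \<open>Existence is essential here: without a solution, uniqueness would hold
  vacuously.\<close>

lemma connected_if_unique:
  assumes unique: "solutions_unique_up_to_scaling d e"
  shows "countries_connected d"
proof (rule ccontr)
  assume "\<not> countries_connected d"
  then obtain J where J: "J \<noteq> {}" "J \<noteq> UNIV"
    and sep: "\<And>j l k. j \<in> J \<Longrightarrow> l \<notin> J \<Longrightarrow> d $ k $ j > 0 \<Longrightarrow> d $ k $ l > 0 \<Longrightarrow> False"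
    unfolding countries_connected_def by blast
  obtain f g where sol: "is_solution d e f g"
    using solution_exists by blast
  \<comment> \<open>No commodity links J to its complement, so halving g on the commodities that
    meet J compensates the doubling of f on J in every supported entry.\<close>
  define f' where "f' = (\<chi> j. if j \<in> J then 2 * f $ j else f $ j)"
  define g' where "g' = (\<chi> i. if \<exists>j\<in>J. d $ i $ j > 0 then g $ i / 2 else g $ i)"
  have K_eq: "d $ i $ j * e $ i $ j / (f' $ j * g' $ i) = d $ i $ j * e $ i $ j / (f $ j * g $ i)" for i j
  proof (cases "d $ i $ j > 0")
    case True
    then have "(\<exists>j\<in>J. d $ i $ j > 0) \<longleftrightarrow> j \<in> J"
      using sep by blast
    then show ?thesis
      by (simp add: f'_def g'_def)
  next
    case False
    then show ?thesis
      using d_nonneg[of i j] by simp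
  qed
  have "f' $ j > 0" "g' $ i > 0" for i j
    using is_solution_pos[OF sol] by (auto simp: f'_def g'_def)
  then have "is_solution d e f' g'"
    using sol unfolding is_solution_iff_scaling K_eq by blast
  then obtain \<delta> where \<delta>: "f' = \<delta> *\<^sub>R f"
    using unique sol unfolding solutions_unique_up_to_scaling_def by blast
  \<comment> \<open>The ratio of \<open>f'\<close> to f is 2 at j and 1 at l, so no single \<delta>
    fits.\<close>
  obtain j l where "j \<in> J" "l \<notin> J"
    using J by blast
  then have "\<delta> * f $ j = 2 * f $ j" "\<delta> * f $ l = f $ l"
    using arg_cong[OF \<delta>, of "\<lambda>x. x $ j"] arg_cong[OF \<delta>, of "\<lambda>x. x $ l"]
    by (simp_all add: f'_def)
  then show False
    using is_solution_pos(1)[OF sol, of j] is_solution_pos(1)[OF sol, of l] by auto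
qed

lemma unique_if_connected:
  assumes conn: "countries_connected d"
  shows "solutions_unique_up_to_scaling d e"
  unfolding solutions_unique_up_to_scaling_def
proof (intro allI impI, elim conjE)
  fix f g f' g'
  assume sol: "is_solution d e f g" and sol': "is_solution d e f' g'"
  have pos: "f $ j > 0" "g $ i > 0" "f' $ j > 0" "g' $ i > 0" for i j
    using is_solution_pos sol sol' by blast+
  define K where "K i j = d $ i $ j * e $ i $ j / (f $ j * g $ i)" for i j
  define \<alpha> where "\<alpha> j = f' $ j / f $ j" for j
  define \<gamma> where "\<gamma> i = g' $ i / g $ i" for i
  have \<alpha>_pos: "\<alpha> j > 0" and \<gamma>_pos: "\<gamma> i > 0" for i j
    using pos by (auto simp: \<alpha>_def \<gamma>_def)
  have K_pos_iff: "K i j > 0 \<longleftrightarrow> d $ i $ j > 0" for i j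
    using de_pos_iff[of i j] pos(1)[of j] pos(2)[of i] by (simp add: K_def pos_less_divide_eq)
  have K_nonneg: "K i j \<ge> 0" for i j
    using d_nonneg e_nonneg pos by (simp add: K_def less_imp_le)
  \<comment> \<open>Passing to the second solution multiplies the entries of K by these factors.
    Since row and column sums agree, the K-weighted mean of the factors is 1 in each row and
    column.\<close>
  have K': "d $ i $ j * e $ i $ j / (f' $ j * g' $ i) = K i j * (1 / (\<alpha> j * \<gamma> i))" for i j
    using pos(1)[of j] pos(2)[of i] by (simp add: K_def \<alpha>_def \<gamma>_def)
  have col: "(\<Sum>i\<in>UNIV. K i j * (1 / (\<alpha> j * \<gamma> i))) = (\<Sum>i\<in>UNIV. K i j)" for j
    using sol sol' unfolding is_solution_iff_scaling K' K_def[symmetric] by simp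
  have row: "(\<Sum>j\<in>UNIV. K i j * (1 / (\<alpha> j * \<gamma> i))) = (\<Sum>j\<in>UNIV. K i j)" for i
    using sol sol' unfolding is_solution_iff_scaling K' K_def[symmetric] by simp
  define A where "A = Max (range \<alpha>)"
  have \<alpha>_le: "\<alpha> j \<le> A" for j
    by (simp add: A_def)
  have A_pos: "A > 0"
    using \<alpha>_pos \<alpha>_le less_le_trans by blast
  have le: "1 / (A * \<gamma> i) \<le> 1 / (\<alpha> j * \<gamma> i)" for i j
    using \<alpha>_le \<alpha>_pos \<gamma>_pos A_pos by (intro divide_left_mono mult_right_mono) (auto simp: less_imp_le)
  \<comment> \<open>Otherwise all factors in row i would exceed 1, contradicting their mean.\<close>
  have le_1: "1 / (A * \<gamma> i) \<le> 1" for i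
  proof (rule ccontr)
    assume gt: "\<not> ?thesis"
    obtain j where "K i j > 0"
      using d_row K_pos_iff by blast
    moreover have "1 / (\<alpha> l * \<gamma> i) > 1" for l
      using gt le[of i l] by linarith
    ultimately show False
      using weighted_sum_extremal[where A = UNIV and c = "K i" and x = "\<lambda>j. 1 / (\<alpha> j * \<gamma> i)"]
        K_nonneg row by (metis UNIV_I finite less_imp_le less_irrefl)
  qed
  \<comment> \<open>In a column where \<alpha> is maximal, \<open>le_1\<close> bounds all factors by
    1, so they equal 1 on the support.\<close>
  have neighbour: "A * \<gamma> i = 1" if "\<alpha> j = A" "d $ i $ j > 0" for i j
  proof -
    have "1 / (\<alpha> j * \<gamma> i) = 1"
      using le_1 K_nonneg col[of j] that K_pos_iff
      by (intro weighted_sum_extremal[where A = UNIV and c = "\<lambda>i. K i j"]) auto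
    then show ?thesis
      using that \<gamma>_pos[of i] A_pos by (simp add: field_simps)
  qed
  \<comment> \<open>Once \<open>A * \<gamma> i = 1\<close>, the factors in row i are
    \<open>A / \<alpha> l\<close>, hence at least 1, so again they equal 1 on the support.\<close>
  have spread: "\<alpha> l = A" if "\<alpha> j = A" "d $ i $ j > 0" "d $ i $ l > 0" for i j l
  proof -
    have A\<gamma>: "A * \<gamma> i = 1"
      using neighbour that by blast
    have "1 / (\<alpha> l * \<gamma> i) = 1"
      using le[of i] A\<gamma> K_nonneg row[of i] that K_pos_iff
      by (intro weighted_sum_extremal[where A = UNIV and c = "K i" and x = "\<lambda>l. 1 / (\<alpha> l * \<gamma> i)"]) auto
    then have "\<alpha> l * \<gamma> i = A * \<gamma> i"
      using A\<gamma> \<gamma>_pos[of i] \<alpha>_pos[of l] by (simp add: field_simps)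
    then show ?thesis
      using \<gamma>_pos[of i] by simp
  qed
  \<comment> \<open>The set of countries where \<alpha> is maximal is nonempty and, by
    \<open>spread\<close>, shares no commodity with its complement; connectedness makes it
    everything.\<close>
  have "A \<in> range \<alpha>"
    unfolding A_def by (intro Max_in) auto
  then have "{j. \<alpha> j = A} \<noteq> {}"
    by auto
  moreover have "\<nexists>k. d $ k $ j > 0 \<and> d $ k $ l > 0"
    if "j \<in> {j. \<alpha> j = A}" "l \<in> UNIV - {j. \<alpha> j = A}" for j l
    using that spread[of j _ l] by auto
  ultimately have "{j. \<alpha> j = A} = UNIV"
    using conn unfolding countries_connected_def by meson
  then have \<alpha>_eq: "\<alpha> j = A" for j
    by auto
  have \<gamma>_eq: "A * \<gamma> i = 1" for i
    using d_row \<alpha>_eq neighbour by blast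
  have "f' $ j = A * f $ j" for j
    using \<alpha>_eq[of j] pos(1)[of j] by (simp add: \<alpha>_def field_simps)
  moreover have "g' $ i = inverse A * g $ i" for i
    using \<gamma>_eq[of i] pos(2)[of i] A_pos by (simp add: \<gamma>_def field_simps)
  ultimately show "\<exists>\<delta>>0. f' = \<delta> *\<^sub>R f \<and> g' = inverse \<delta> *\<^sub>R g"
    using A_pos by (intro exI[of _ A]) (simp add: vec_eq_iff)
qed

end

theorem theorem5:
  fixes q d e :: "real ^ 'm ^ 'n"
  assumes q_nonneg: "\<And>i j. q $ i $ j \<ge> 0"
    and q_row: "\<And>i. \<exists>j. q $ i $ j > 0"
    and q_col: "\<And>j. \<exists>i. q $ i $ j > 0"
    and d_nonneg: "\<And>i j. d $ i $ j \<ge> 0"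
    and e_nonneg: "\<And>i j. e $ i $ j \<ge> 0"
    and d_pos_iff: "\<And>i j. d $ i $ j > 0 \<longleftrightarrow> e $ i $ j > 0"
    and e_pos_iff: "\<And>i j. e $ i $ j > 0 \<longleftrightarrow> q $ i $ j > 0"
  shows "countries_connected q \<longleftrightarrow> solutions_unique_up_to_scaling d e"
proof -
  interpret same_support d e
    using assms by unfold_locales auto
  have "countries_connected q \<longleftrightarrow> countries_connected d"
    using d_pos_iff e_pos_iff by (simp add: countries_connected_def)
  then show ?thesis
    using connected_if_unique unique_if_connected by blast
qed

end
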